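(* For every finite semigroup $S$ there exist a finitely presented congruence-free monoid $M$ and an injective semigroup homomorphism $S\to M$.
   Context: A congruence on a monoid $M$ is an equivalence relation $\rho$ on $M$ such that $u\,\rho\,v$ implies $(aub)\,\rho\,(avb)$ for all $a,b\in M$. A monoid $M$ is congruence-free if its only congruences are the equality relation and the universal relation $M\times M$. A monoid is finitely presented if it is isomorphic to the quotient of the free monoid $A^*$ on a finite set $A$ by the congruence generated by a finite set $R\subseteq A^*\times A^*$. A semigroup $S$ embeds in a monoid $M$ if there is an injective map $S\to M$ preserving multiplication (if $S$ happens to have an identity, it is not required to be mapped to the identity of $M$). *)

theory Defs
  imports "HOL-Algebra.Group"
begin

text \<open>
  HOL-Algebra provides no carrier-based semigroups, so a semigroup is given by the carrier and
  multiplication of a \<open>monoid\<close> record. The field \<^term>\<open>one\<close> of that record is a junk value: it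
  occurs neither below nor in \<^term>\<open>hom\<close> and \<^term>\<open>mon\<close>, so an embedding of a semigroup
  is not asked to preserve identities.
\<close>

locale semigroup_carrier =
  fixes S (structure)
  assumes m_closed: "\<lbrakk>x \<in> carrier S; y \<in> carrier S\<rbrakk> \<Longrightarrow> x \<otimes> y \<in> carrier S"
    and m_assoc: "\<lbrakk>x \<in> carrier S; y \<in> carrier S; z \<in> carrier S\<rbrakk>
      \<Longrightarrow> (x \<otimes> y) \<otimes> z = x \<otimes> (y \<otimes> z)"

definition congruence_on :: "('a, 'b) monoid_scheme \<Rightarrow> ('a \<times> 'a) set \<Rightarrow> bool" where
  "congruence_on M \<rho> \<longleftrightarrow> equiv (carrier M) \<rho> \<and>
     (\<forall>(u, v) \<in> \<rho>. \<forall>a \<in> carrier M. \<forall>b \<in> carrier M.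
        (a \<otimes>\<^bsub>M\<^esub> u \<otimes>\<^bsub>M\<^esub> b, a \<otimes>\<^bsub>M\<^esub> v \<otimes>\<^bsub>M\<^esub> b) \<in> \<rho>)"

definition congruence_free :: "('a, 'b) monoid_scheme \<Rightarrow> bool" where
  "congruence_free M \<longleftrightarrow>
     (\<forall>\<rho>. congruence_on M \<rho> \<longrightarrow> \<rho> = Id_on (carrier M) \<or> \<rho> = carrier M \<times> carrier M)"

definition congruence_generated ::
    "('a, 'b) monoid_scheme \<Rightarrow> ('a \<times> 'a) set \<Rightarrow> ('a \<times> 'a) set" where
  "congruence_generated M R = \<Inter>{\<rho>. congruence_on M \<rho> \<and> R \<subseteq> \<rho>}"

definition quotient_monoid ::
    "('a, 'b) monoid_scheme \<Rightarrow> ('a \<times> 'a) set \<Rightarrow> 'a set monoid" where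
  "quotient_monoid M \<rho> =
     \<lparr>carrier = carrier M // \<rho>,
      mult = (\<lambda>X Y. \<Union>x \<in> X. \<Union>y \<in> Y. \<rho> `` {x \<otimes>\<^bsub>M\<^esub> y}),
      one = \<rho> `` {\<one>\<^bsub>M\<^esub>}\<rparr>"

definition free_monoid :: "'x set \<Rightarrow> 'x list monoid" where
  "free_monoid A = \<lparr>carrier = lists A, mult = (@), one = []\<rparr>"

definition presented_monoid :: "'x set \<Rightarrow> ('x list \<times> 'x list) set \<Rightarrow> 'x list set monoid" where
  "presented_monoid A R =
     quotient_monoid (free_monoid A) (congruence_generated (free_monoid A) R)"

text \<open>
  Generators are drawn from \<^typ>\<open>nat\<close> because a definition cannot quantify over the type of
  the generating set; every finite set is in bijection with a finite set of natural numbers.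
  Hence, up to isomorphism, all finitely presented monoids occur on the type \<^typ>\<open>nat list set\<close>.
  For monoids, \<^term>\<open>(\<cong>)\<close> is monoid isomorphism, since a surjective multiplicative map
  sends identity to identity.
\<close>

definition finitely_presented :: "('a, 'b) monoid_scheme \<Rightarrow> bool" where
  "finitely_presented M \<longleftrightarrow>
     (\<exists>(A :: nat set) R. finite A \<and> finite R \<and> R \<subseteq> lists A \<times> lists A \<and>
        M \<cong> presented_monoid A R)"

lemma monoid_free_monoid: "monoid (free_monoid A)"
  by (rule monoidI) (auto simp: free_monoid_def)

lemma congruence_on_mult:
  assumes M: "monoid M" and \<rho>: "congruence_on M \<rho>"
    and "(x, x') \<in> \<rho>" and "(y, y') \<in> \<rho>"
  shows "(x \<otimes>\<^bsub>M\<^esub> y, x' \<otimes>\<^bsub>M\<^esub> y') \<in> \<rho>"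
proof -
  interpret monoid M by fact
  have eq: "equiv (carrier M) \<rho>"
    using \<rho> by (simp add: congruence_on_def)
  have cong: "(a \<otimes>\<^bsub>M\<^esub> u \<otimes>\<^bsub>M\<^esub> b, a \<otimes>\<^bsub>M\<^esub> v \<otimes>\<^bsub>M\<^esub> b) \<in> \<rho>"
    if "(u, v) \<in> \<rho>" "a \<in> carrier M" "b \<in> carrier M" for u v a b
    using \<rho> that unfolding congruence_on_def by blast
  have mem: "x \<in> carrier M" "x' \<in> carrier M" "y \<in> carrier M" "y' \<in> carrier M"
    using eq assms(3,4) by (auto simp: equiv_def)
  have "(x \<otimes>\<^bsub>M\<^esub> y, x' \<otimes>\<^bsub>M\<^esub> y) \<in> \<rho>"
    using cong[OF assms(3) one_closed mem(3)] mem by simp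
  moreover have "(x' \<otimes>\<^bsub>M\<^esub> y, x' \<otimes>\<^bsub>M\<^esub> y') \<in> \<rho>"
    using cong[OF assms(4) mem(2) one_closed] mem by simp
  ultimately show ?thesis
    using eq unfolding equiv_def by (blast dest: transD)
qed

lemma congruence_on_universal:
  assumes "monoid M"
  shows "congruence_on M (carrier M \<times> carrier M)"
proof -
  interpret monoid M by fact
  show ?thesis
    by (auto simp: congruence_on_def equiv_def refl_on_def sym_def trans_def)
qed

lemma congruence_on_Id_on:
  assumes "monoid M"
  shows "congruence_on M (Id_on (carrier M))"
proof -
  interpret monoid M by fact
  show ?thesis
    by (auto simp: congruence_on_def equiv_def refl_on_def sym_def trans_def)
qed

lemma congruence_on_generated:
  assumes "monoid M" and "R \<subseteq> carrier M \<times> carrier M"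
  shows "congruence_on M (congruence_generated M R)"
proof -
  let ?C = "{\<rho>. congruence_on M \<rho> \<and> R \<subseteq> \<rho>}"
  have "carrier M \<times> carrier M \<in> ?C"
    using assms congruence_on_universal by blast
  hence sub: "\<Inter>?C \<subseteq> carrier M \<times> carrier M"
    by blast
  have eq: "equiv (carrier M) \<rho>" if "\<rho> \<in> ?C" for \<rho>
    using that by (simp add: congruence_on_def)
  have "equiv (carrier M) (\<Inter>?C)"
  proof (rule equivI)
    show "\<Inter>?C \<subseteq> carrier M \<times> carrier M"
      by (rule sub)
    show "refl_on (carrier M) (\<Inter>?C)"
    proof (rule refl_onI)
      fix x assume "x \<in> carrier M"
      thus "(x, x) \<in> \<Inter>?C"
        using eq by (force simp: equiv_def refl_on_def)
    qed
    show "sym (\<Inter>?C)"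
    proof (rule symI)
      fix x y assume xy: "(x, y) \<in> \<Inter>?C"
      show "(y, x) \<in> \<Inter>?C"
      proof
        fix \<rho> assume "\<rho> \<in> ?C"
        with eq[OF this] xy show "(y, x) \<in> \<rho>"
          unfolding equiv_def by (blast dest: symD)
      qed
    qed
    show "trans (\<Inter>?C)"
    proof (rule transI)
      fix x y z assume xy: "(x, y) \<in> \<Inter>?C" and yz: "(y, z) \<in> \<Inter>?C"
      show "(x, z) \<in> \<Inter>?C"
      proof
        fix \<rho> assume "\<rho> \<in> ?C"
        with eq[OF this] xy yz show "(x, z) \<in> \<rho>"
          unfolding equiv_def by (blast dest: transD)
      qed
    qed
  qed
  thus ?thesis
    unfolding congruence_generated_def congruence_on_def by blast
qed

lemma quotient_monoid_mult:
  assumes M: "monoid M" and \<rho>: "congruence_on M \<rho>"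
    and x: "x \<in> carrier M" and y: "y \<in> carrier M"
  shows "\<rho> `` {x} \<otimes>\<^bsub>quotient_monoid M \<rho>\<^esub> \<rho> `` {y} = \<rho> `` {x \<otimes>\<^bsub>M\<^esub> y}"
proof -
  have eq: "equiv (carrier M) \<rho>"
    using \<rho> by (simp add: congruence_on_def)
  have const: "\<rho> `` {a \<otimes>\<^bsub>M\<^esub> b} = \<rho> `` {x \<otimes>\<^bsub>M\<^esub> y}" if "a \<in> \<rho> `` {x}" "b \<in> \<rho> `` {y}" for a b
  proof -
    have "(x \<otimes>\<^bsub>M\<^esub> y, a \<otimes>\<^bsub>M\<^esub> b) \<in> \<rho>"
      using congruence_on_mult[OF M \<rho>] that by simp
    thus ?thesis
      using equiv_class_eq[OF eq] by simp
  qed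
  have "x \<in> \<rho> `` {x}" "y \<in> \<rho> `` {y}"
    using equiv_class_self[OF eq] x y by auto
  hence "(\<Union>a \<in> \<rho> `` {x}. \<Union>b \<in> \<rho> `` {y}. \<rho> `` {a \<otimes>\<^bsub>M\<^esub> b}) = \<rho> `` {x \<otimes>\<^bsub>M\<^esub> y}"
    using const by blast
  thus ?thesis
    by (simp add: quotient_monoid_def)
qed

lemma monoid_quotient_monoid:
  assumes M: "monoid M" and \<rho>: "congruence_on M \<rho>"
  shows "monoid (quotient_monoid M \<rho>)"
proof -
  interpret monoid M by fact
  have carr: "carrier (quotient_monoid M \<rho>) = carrier M // \<rho>"
    and one: "\<one>\<^bsub>quotient_monoid M \<rho>\<^esub> = \<rho> `` {\<one>\<^bsub>M\<^esub>}"
    by (simp_all add: quotient_monoid_def)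
  note mult = quotient_monoid_mult[OF M \<rho>]
  show ?thesis
    by (rule monoidI)
      (auto simp: carr one mult m_assoc elim!: quotientE intro!: quotientI)
qed

lemma monoid_presented_monoid:
  assumes "R \<subseteq> lists A \<times> lists A"
  shows "monoid (presented_monoid A R)"
  unfolding presented_monoid_def
  using assms monoid_free_monoid
  by (intro monoid_quotient_monoid congruence_on_generated) (auto simp: free_monoid_def)

end

theory Submission
  imports Defs
begin

text \<open>
  Adjoin an identity to \<open>S\<close> to get a finite monoid \<open>G\<close> and let \<open>G\<close> act on \<open>\<Omega> = G \<union> {\<infinity>}\<close> by left
  multiplication, fixing \<open>\<infinity>\<close>; no element of \<open>G\<close> acts as a constant map. Words over \<open>\<Omega>\<close> carry the
  partial maps \<open>q\<^sub>x\<close> (put the letter \<open>x\<close> in front), \<open>p\<^sub>B\<close> (delete the first letter if it belongs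
  to \<open>B\<close>) and \<open>t\<^sub>s\<close> (multiply the first letter by \<open>s\<close>). They satisfy finitely many relations that
  reduce every product to the zero \<open>p\<^sub>\<emptyset>\<close> or to \<open>q\<^sub>x\<dots>q\<^sub>y t\<^sub>s p\<^sub>B\<dots>p\<^sub>C\<close> with nonempty
  \<open>B, \<dots>, C\<close>. Distinct such normal forms differ on arbitrarily long words, because no \<open>t\<^sub>s\<close> is
  constant. If \<open>w\<close> is long, then \<open>u q\<^sub>w\<close> is zero or the product \<open>q\<^sub>v\<close>, where \<open>v\<close> is the image of
  \<open>w\<close> under \<open>u\<close>; and a congruence that identifies \<open>q\<^sub>v\<close> with \<open>0\<close> or with \<open>q\<^sub>z\<close> for some \<open>z \<noteq> v\<close>
  identifies \<open>1\<close> with \<open>0\<close>. So a congruence that keeps \<open>1\<close> and \<open>0\<close> apart is the equality.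
\<close>

section \<open>Generated congruences and congruences on a quotient\<close>

lemma free_monoid_simps [simp]:
  "carrier (free_monoid A) = lists A" "x \<otimes>\<^bsub>free_monoid A\<^esub> y = x @ y" "\<one>\<^bsub>free_monoid A\<^esub> = []"
  by (simp_all add: free_monoid_def)

lemma congruence_generated_least:
  "congruence_on M \<rho> \<Longrightarrow> R \<subseteq> \<rho> \<Longrightarrow> congruence_generated M R \<subseteq> \<rho>"
  unfolding congruence_generated_def by blast

lemma subset_congruence_generated: "R \<subseteq> congruence_generated M R"
  unfolding congruence_generated_def by blast

text \<open>Correspondence theorem: a congruence on the quotient pulls back along the projection to
  a congruence on \<open>M\<close> containing \<open>\<gamma>\<close>. A pullback equal to
  \<open>\<gamma>\<close> comes from equality, a universal one from the universal relation.\<close>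

lemma congruence_free_quotient_monoid:
  assumes M: "monoid M" and \<gamma>: "congruence_on M \<gamma>"
    and max: "\<And>\<sigma>. congruence_on M \<sigma> \<Longrightarrow> \<gamma> \<subseteq> \<sigma> \<Longrightarrow> \<sigma> = \<gamma> \<or> \<sigma> = carrier M \<times> carrier M"
  shows "congruence_free (quotient_monoid M \<gamma>)"
  unfolding congruence_free_def
proof (intro allI impI)
  fix \<rho> let ?Q = "quotient_monoid M \<gamma>" and ?c = "\<lambda>u. \<gamma> `` {u}"
  assume \<rho>: "congruence_on ?Q \<rho>"
  interpret monoid M by fact
  have eq\<gamma>: "equiv (carrier M) \<gamma>" and eq\<rho>: "equiv (carrier ?Q) \<rho>"
    using \<gamma> \<rho> by (simp_all add: congruence_on_def)
  have carr: "carrier ?Q = ?c ` carrier M"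
    by (auto simp: quotient_monoid_def quotient_def)
  define \<sigma> where "\<sigma> = {(u, v) \<in> carrier M \<times> carrier M. (?c u, ?c v) \<in> \<rho>}"
  have "equiv (carrier M) \<sigma>"
  proof (rule equivI)
    show "\<sigma> \<subseteq> carrier M \<times> carrier M" by (auto simp: \<sigma>_def)
    show "refl_on (carrier M) \<sigma>"
      using eq\<rho> by (auto simp: \<sigma>_def equiv_def refl_on_def carr)
    show "sym \<sigma>"
      using eq\<rho> by (auto simp: \<sigma>_def equiv_def intro!: symI dest: symD)
    show "trans \<sigma>"
      using eq\<rho> unfolding \<sigma>_def equiv_def by (auto intro!: transI dest: transD)
  qed
  moreover have "(a \<otimes>\<^bsub>M\<^esub> u \<otimes>\<^bsub>M\<^esub> b, a \<otimes>\<^bsub>M\<^esub> v \<otimes>\<^bsub>M\<^esub> b) \<in> \<sigma>"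
    if uv: "(u, v) \<in> \<sigma>" and ab: "a \<in> carrier M" "b \<in> carrier M" for u v a b
  proof -
    have "(?c a \<otimes>\<^bsub>?Q\<^esub> ?c u \<otimes>\<^bsub>?Q\<^esub> ?c b, ?c a \<otimes>\<^bsub>?Q\<^esub> ?c v \<otimes>\<^bsub>?Q\<^esub> ?c b) \<in> \<rho>"
      using \<rho> uv ab unfolding congruence_on_def \<sigma>_def carr by blast
    then show ?thesis
      using uv ab by (simp add: \<sigma>_def quotient_monoid_mult[OF M \<gamma>])
  qed
  ultimately have "congruence_on M \<sigma>"
    unfolding congruence_on_def by blast
  moreover have "\<gamma> \<subseteq> \<sigma>"
  proof
    fix z assume z: "z \<in> \<gamma>"
    obtain u v where uv: "z = (u, v)" by force
    have mem: "u \<in> carrier M" "v \<in> carrier M"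
      using eq\<gamma> z uv by (auto simp: equiv_def)
    have "?c u = ?c v"
      using equiv_class_eq[OF eq\<gamma>] z uv by simp
    moreover have "(?c v, ?c v) \<in> \<rho>"
      using eq\<rho> mem by (auto simp: equiv_def refl_on_def carr)
    ultimately show "z \<in> \<sigma>"
      using mem uv by (simp add: \<sigma>_def)
  qed
  ultimately consider "\<sigma> = \<gamma>" | "\<sigma> = carrier M \<times> carrier M"
    using max by blast
  then show "\<rho> = Id_on (carrier ?Q) \<or> \<rho> = carrier ?Q \<times> carrier ?Q"
  proof cases
    case 1
    have "\<rho> \<subseteq> Id_on (carrier ?Q)"
    proof
      fix z assume z: "z \<in> \<rho>"
      then obtain u v where uv: "z = (?c u, ?c v)" "u \<in> carrier M" "v \<in> carrier M"
        using eq\<rho> by (force simp: equiv_def carr)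
      then have "(u, v) \<in> \<sigma>" using z by (simp add: \<sigma>_def)
      then have "(u, v) \<in> \<gamma>" using 1 by simp
      then have "?c u = ?c v" by (rule equiv_class_eq[OF eq\<gamma>])
      then show "z \<in> Id_on (carrier ?Q)" using uv carr by auto
    qed
    moreover have "Id_on (carrier ?Q) \<subseteq> \<rho>"
      using eq\<rho> by (auto simp: equiv_def refl_on_def)
    ultimately show ?thesis by blast
  next
    case 2
    then have "(u, v) \<in> \<sigma>" if "u \<in> carrier M" "v \<in> carrier M" for u v
      using that by blast
    then have "carrier ?Q \<times> carrier ?Q \<subseteq> \<rho>"
      by (auto simp: carr \<sigma>_def)
    moreover have "\<rho> \<subseteq> carrier ?Q \<times> carrier ?Q"
      using eq\<rho> by (auto simp: equiv_def)
    ultimately show ?thesis by blast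
  qed
qed

section \<open>Adjoining an identity\<close>

text \<open>The identity \<open>None\<close> is new even if \<open>S\<close> already has one. Left
  multiplication on the enlarged carrier is faithful, since \<open>s\<close> is recovered as its
  value at the identity.\<close>

definition adjoin_one :: "('a, 'b) monoid_scheme \<Rightarrow> 'a option monoid" where
  "adjoin_one S =
     \<lparr>carrier = insert None (Some ` carrier S),
      mult = (\<lambda>x y. case x of None \<Rightarrow> y
        | Some a \<Rightarrow> (case y of None \<Rightarrow> x | Some b \<Rightarrow> Some (a \<otimes>\<^bsub>S\<^esub> b))),
      one = None\<rparr>"

lemma monoid_adjoin_one:
  assumes "semigroup_carrier S"
  shows "monoid (adjoin_one S)"
proof -
  interpret semigroup_carrier S by fact
  show ?thesis
    by (rule monoidI) (auto simp: adjoin_one_def m_closed m_assoc)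
qed

lemma Some_in_mon_adjoin_one: "Some \<in> mon S (adjoin_one S)"
  by (auto simp: mon_def hom_def adjoin_one_def)

section \<open>The letters and the defining relations\<close>

text \<open>\<^term>\<open>None\<close> is the fixed point \<open>\<infinity>\<close>; the constructors stand for \<open>q\<^sub>x\<close>, \<open>p\<^sub>B\<close> and \<open>t\<^sub>s\<close>.\<close>

datatype (dead 'a) letter = Push "'a option" | Pop "'a option set" | Scale 'a

text \<open>The extra point guarantees two distinct points even when \<open>G\<close> is trivial,
  and a value of each scaling that differs from its values on \<open>carrier G\<close>.\<close>

definition points :: "('a, 'b) monoid_scheme \<Rightarrow> 'a option set" where
  "points G = insert None (Some ` carrier G)"

definition letters :: "('a, 'b) monoid_scheme \<Rightarrow> 'a letter set" where
  "letters G = Push ` points G \<union> Pop ` Pow (points G) \<union> Scale ` carrier G"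

text \<open>The coding is there because \<open>finitely_presented\<close> takes generators from
  \<nat>; any injection on the finite set of letters serves.\<close>

locale coded_letters = monoid G for G :: "('a, 'b) monoid_scheme" (structure) +
  fixes code :: "'a letter \<Rightarrow> nat"
  assumes finite_carrier: "finite (carrier G)"
    and inj_code: "inj_on code (letters G)"
begin

abbreviation "\<Omega> \<equiv> points G"
abbreviation "q x \<equiv> code (Push x)"
abbreviation "p B \<equiv> code (Pop B)"
abbreviation "t s \<equiv> code (Scale s)"
abbreviation "A \<equiv> code ` letters G"
abbreviation "F \<equiv> free_monoid A"
abbreviation "zero \<equiv> [p {}]"

definition scale :: "'a \<Rightarrow> 'a option \<Rightarrow> 'a option" where
  "scale s = map_option (mult G s)"

definition preim :: "'a \<Rightarrow> 'a option set \<Rightarrow> 'a option set" where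
  "preim s B = {x \<in> \<Omega>. scale s x \<in> B}"

text \<open>Read from left to right these are rewrite rules. Normal forms list pushes, one scaling,
  then pops; the first four rules treat the adjacent pairs \<open>p q\<close>, \<open>t q\<close>,
  \<open>p t\<close> and \<open>t t\<close> that violate this pattern. Scaling by \<open>s\<close>
  and then testing for \<open>B\<close> amounts to testing for \<open>preim s B\<close>. The letter
  \<open>p {}\<close> is the zero because deletion from the empty set is nowhere defined.\<close>

inductive_set rels :: "(nat list \<times> nat list) set" where
  pop_push: "B \<subseteq> \<Omega> \<Longrightarrow> x \<in> \<Omega> \<Longrightarrow> ([p B, q x], if x \<in> B then [] else zero) \<in> rels"
| scale_push: "s \<in> carrier G \<Longrightarrow> x \<in> \<Omega> \<Longrightarrow> ([t s, q x], [q (scale s x)]) \<in> rels"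
| pop_scale: "B \<subseteq> \<Omega> \<Longrightarrow> s \<in> carrier G \<Longrightarrow> ([p B, t s], [p (preim s B)]) \<in> rels"
| scale_mult: "s \<in> carrier G \<Longrightarrow> r \<in> carrier G \<Longrightarrow> ([t s, t r], [t (s \<otimes> r)]) \<in> rels"
| scale_one: "([t \<one>], []) \<in> rels"
| zero_right: "a \<in> A \<Longrightarrow> ([a, p {}], zero) \<in> rels"
| zero_left: "a \<in> A \<Longrightarrow> ([p {}, a], zero) \<in> rels"

lemma finite_points: "finite \<Omega>"
  using finite_carrier by (simp add: points_def)

lemma finite_letters: "finite (letters G)"
  using finite_carrier finite_points by (simp add: letters_def)

lemma letters_cases [consumes 1, case_names push pop scale]:
  assumes "a \<in> A"
  obtains x where "x \<in> \<Omega>" "a = q x" | B where "B \<subseteq> \<Omega>" "a = p B" | s where "s \<in> carrier G" "a = t s"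
  using assms by (auto simp: letters_def)

lemma in_alphabet [simp]:
  "x \<in> \<Omega> \<Longrightarrow> q x \<in> A" "B \<subseteq> \<Omega> \<Longrightarrow> p B \<in> A" "s \<in> carrier G \<Longrightarrow> t s \<in> A"
  by (auto simp: letters_def)

lemma scale_closed [simp]: "s \<in> carrier G \<Longrightarrow> x \<in> \<Omega> \<Longrightarrow> scale s x \<in> \<Omega>"
  by (auto simp: scale_def points_def)

lemma scale_scale:
  "s \<in> carrier G \<Longrightarrow> r \<in> carrier G \<Longrightarrow> x \<in> \<Omega> \<Longrightarrow> scale s (scale r x) = scale (s \<otimes> r) x"
  by (auto simp: scale_def points_def m_assoc)

lemma scale_by_one: "x \<in> \<Omega> \<Longrightarrow> scale \<one> x = x"
  by (auto simp: scale_def points_def)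

lemma preim_subset [simp]: "preim s B \<subseteq> \<Omega>"
  by (auto simp: preim_def)

lemma rels_subset: "rels \<subseteq> lists A \<times> lists A"
  by (auto elim!: rels.cases split: if_splits)

lemma finite_rels: "finite rels"
proof (rule finite_subset)
  let ?L = "{u. set u \<subseteq> A \<and> length u \<le> 2}"
  show "rels \<subseteq> ?L \<times> ?L"
    by (auto elim!: rels.cases split: if_splits)
  show "finite (?L \<times> ?L)"
    using finite_letters by (intro finite_cartesian_product finite_lists_length_le finite_imageI)
qed

lemma monoid_F: "monoid F"
  by (rule monoid_free_monoid)

section \<open>The action by partial maps on words over \<Omega>\<close>

primrec letter_act :: "'a letter \<Rightarrow> 'a option list \<Rightarrow> 'a option list option" where
  "letter_act (Push x) w = Some (x # w)"
| "letter_act (Pop B) w = (case w of [] \<Rightarrow> None | x # w' \<Rightarrow> if x \<in> B then Some w' else None)"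
| "letter_act (Scale s) w = Some (case w of [] \<Rightarrow> [] | x # w' \<Rightarrow> scale s x # w')"

text \<open>Words act like products of left operators: the last letter acts first, and
  \<open>None\<close> means undefined. \<open>inv_into\<close> decodes a number, which is meaningful
  on \<open>A\<close>.\<close>

primrec word_act :: "nat list \<Rightarrow> 'a option list \<Rightarrow> 'a option list option" where
  "word_act [] w = Some w"
| "word_act (a # u) w = Option.bind (word_act u w) (letter_act (inv_into (letters G) code a))"

lemma letter_act_code [simp]:
  "x \<in> \<Omega> \<Longrightarrow> letter_act (inv_into (letters G) code (q x)) = letter_act (Push x)"
  "B \<subseteq> \<Omega> \<Longrightarrow> letter_act (inv_into (letters G) code (p B)) = letter_act (Pop B)"
  "s \<in> carrier G \<Longrightarrow> letter_act (inv_into (letters G) code (t s)) = letter_act (Scale s)"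
  by (subst inv_into_f_f[OF inj_code]; simp add: letters_def)+

lemma word_act_append: "word_act (u @ v) w = Option.bind (word_act v w) (word_act u)"
  by (induction u) (cases "word_act v w"; simp)+

lemma letter_act_closed:
  assumes "a \<in> A" "w \<in> lists \<Omega>" "letter_act (inv_into (letters G) code a) w = Some w'"
  shows "w' \<in> lists \<Omega>"
  using assms(1)
proof (cases rule: letters_cases)
  case push then show ?thesis using assms by auto
next
  case pop then show ?thesis using assms by (auto split: list.splits if_splits)
next
  case scale then show ?thesis using assms by (auto split: list.splits)
qed

lemma word_act_closed:
  "u \<in> lists A \<Longrightarrow> w \<in> lists \<Omega> \<Longrightarrow> word_act u w = Some w' \<Longrightarrow> w' \<in> lists \<Omega>"
proof (induction u arbitrary: w')
  case (Cons a u)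
  then obtain w1 where "word_act u w = Some w1"
    "letter_act (inv_into (letters G) code a) w1 = Some w'"
    by (auto simp: bind_eq_Some_conv)
  then show ?case using Cons letter_act_closed[of a w1 w'] by auto
qed simp

text \<open>Each letter removes at most one point. Hence a word at least as long as the acting word
  is never exhausted before the last letter acts.\<close>

lemma length_word_act:
  "u \<in> lists A \<Longrightarrow> w \<in> lists \<Omega> \<Longrightarrow> word_act u w = Some w' \<Longrightarrow> length w \<le> length w' + length u"
proof (induction u arbitrary: w')
  case (Cons a u)
  then obtain w1 where w1: "word_act u w = Some w1"
    and a: "letter_act (inv_into (letters G) code a) w1 = Some w'"
    by (auto simp: bind_eq_Some_conv)
  have "a \<in> A" using Cons by simp
  then have "length w1 \<le> Suc (length w')"
    using a by (cases rule: letters_cases) (auto split: list.splits if_splits)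
  then show ?case using Cons w1 by fastforce
qed simp

text \<open>The kernel of the action. It is a congruence containing \<open>rels\<close>, so it
  contains the generated one: words equal in the presented monoid act equally.\<close>

definition same_action :: "(nat list \<times> nat list) set" where
  "same_action = {(u, v) \<in> lists A \<times> lists A. \<forall>w \<in> lists \<Omega>. word_act u w = word_act v w}"

lemma congruence_same_action: "congruence_on F same_action"
  unfolding congruence_on_def
proof
  show "equiv (carrier F) same_action"
    by (rule equivI)
      (auto simp: same_action_def refl_on_def sym_def trans_def)
  show "\<forall>(u, v)\<in>same_action. \<forall>a\<in>carrier F. \<forall>b\<in>carrier F.
    (a \<otimes>\<^bsub>F\<^esub> u \<otimes>\<^bsub>F\<^esub> b, a \<otimes>\<^bsub>F\<^esub> v \<otimes>\<^bsub>F\<^esub> b) \<in> same_action"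
  proof (intro ballI, clarify)
    fix u v a b assume "(u, v) \<in> same_action" "a \<in> carrier F" "b \<in> carrier F"
    then have mem: "u \<in> lists A" "v \<in> lists A" "a \<in> lists A" "b \<in> lists A"
      and eq: "\<And>w. w \<in> lists \<Omega> \<Longrightarrow> word_act u w = word_act v w"
      by (simp_all add: same_action_def)
    have "word_act (a @ u @ b) w = word_act (a @ v @ b) w" if "w \<in> lists \<Omega>" for w
      using eq word_act_closed[OF mem(4) that]
      by (cases "word_act b w") (simp_all add: word_act_append)
    then show "(a \<otimes>\<^bsub>F\<^esub> u \<otimes>\<^bsub>F\<^esub> b, a \<otimes>\<^bsub>F\<^esub> v \<otimes>\<^bsub>F\<^esub> b) \<in> same_action"
      using mem by (simp add: same_action_def)
  qed
qed

lemma word_act_zero [simp]: "word_act (p {} # u) w = None"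
  by (cases "word_act u w") (auto split: list.splits)

lemma word_act_rels:
  assumes "(u, v) \<in> rels" "w \<in> lists \<Omega>"
  shows "word_act u w = word_act v w"
proof -
  have zero: "Option.bind r (letter_act (Pop {})) = None" for r
    by (cases r) (auto split: list.splits)
  from assms(1) show ?thesis
    by cases (use assms(2) in \<open>cases w;
      auto simp: zero scale_scale scale_by_one preim_def split: if_splits\<close>)+
qed

lemma rels_same_action: "rels \<subseteq> same_action"
  unfolding same_action_def using word_act_rels rels_subset by blast

section \<open>Normal forms are separated by their action on long words\<close>

text \<open>Exactly one scaling letter is always present, possibly \<open>t \<one>\<close>; this
  makes the form unique once the sets in \<open>Bs\<close> are nonempty.\<close>

definition nf :: "'a option list \<Rightarrow> 'a \<Rightarrow> 'a option set list \<Rightarrow> nat list" where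
  "nf I s Bs = map (\<lambda>x. q x) I @ t s # map (\<lambda>B. p B) Bs"

abbreviation "nonempty_sets \<equiv> Pow \<Omega> - {{}}"

lemma word_act_push: "I \<in> lists \<Omega> \<Longrightarrow> word_act (map (\<lambda>x. q x) I) w = Some (I @ w)"
  by (induction I) auto

lemma word_act_nf_Nil:
  "I \<in> lists \<Omega> \<Longrightarrow> s \<in> carrier G \<Longrightarrow> word_act (nf I s []) (x # w) = Some (I @ scale s x # w)"
  by (simp add: nf_def word_act_append word_act_push)

text \<open>The last set is the one that tests the first point of the input, which is why the
  inductions below peel \<open>Bs\<close> from the right.\<close>

lemma word_act_nf_snoc:
  "B \<subseteq> \<Omega> \<Longrightarrow>
    word_act (nf I s (Bs @ [B])) (x # w) = (if x \<in> B then word_act (nf I s Bs) w else None)"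
proof -
  assume "B \<subseteq> \<Omega>"
  moreover have "nf I s (Bs @ [B]) = nf I s Bs @ [p B]" by (simp add: nf_def)
  ultimately show ?thesis by (simp only: word_act_append) simp
qed

text \<open>An input on which the form is defined starts with one point from each set, the last set
  first, followed by padding. The bound \<open>N\<close> is there because later comparisons only
  concern long words.\<close>

lemma nf_not_zero:
  assumes "I \<in> lists \<Omega>" "s \<in> carrier G" "Bs \<in> lists nonempty_sets"
  shows "\<exists>w \<in> lists \<Omega>. N \<le> length w \<and> word_act (nf I s Bs) w \<noteq> None"
  using assms(3)
proof (induction Bs rule: rev_induct)
  case Nil
  have "word_act (nf I s []) (None # replicate N None) \<noteq> None"
    using assms by (simp add: word_act_nf_Nil)
  moreover have "None # replicate N None \<in> lists \<Omega>"
    by (auto simp: points_def)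
  ultimately show ?case
    by (intro bexI[of _ "None # replicate N None"]) simp_all
next
  case (snoc B Bs)
  then obtain w where w: "w \<in> lists \<Omega>" "N \<le> length w" "word_act (nf I s Bs) w \<noteq> None"
    by auto
  obtain x where "x \<in> B" "B \<subseteq> \<Omega>" using snoc.prems by auto
  with w show ?case
    by (intro bexI[of _ "x # w"]) (auto simp: word_act_nf_snoc)
qed

text \<open>The form ending in a pop discards the first point after testing it, so where defined its
  value does not depend on that point. The other form displays the scaled first point, and scalings
  are not constant.\<close>

lemma nf_Nil_neq_snoc:
  assumes "I \<in> lists \<Omega>" "s \<in> carrier G" "C \<subseteq> \<Omega>"
    and eq: "\<And>w. w \<in> lists \<Omega> \<Longrightarrow> N \<le> length w \<Longrightarrow>
      word_act (nf I s []) w = word_act (nf J r (Cs @ [C])) w"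
  shows False
proof -
  let ?w = "replicate N None"
  have w: "x # ?w \<in> lists \<Omega>" if "x \<in> \<Omega>" for x
    using that by (auto simp: points_def)
  have "Some (I @ scale s x # ?w) = word_act (nf J r Cs) ?w" if "x \<in> \<Omega>" for x
    using eq[OF w[OF that]] assms(1-3)
    by (simp add: word_act_nf_Nil word_act_nf_snoc split: if_splits)
  \<comment> \<open>Scaling fixes \<open>None\<close> but sends \<open>Some \<one>\<close> to a
    point of the form \<open>Some _\<close>.\<close>
  from this[of None] this[of "Some \<one>"]
  have "Some (I @ scale s None # ?w) = Some (I @ scale s (Some \<one>) # ?w)"
    by (simp add: points_def)
  then show False by (simp add: scale_def)
qed

text \<open>The last set consists of the first points accepted with some long continuation; after an
  accepted point the shorter forms agree. Once no set is left, the value on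
  \<open>Some \<one>\<close> followed by padding shows both the pushed prefix and the
  scalar.\<close>

lemma nf_faithful:
  assumes "I \<in> lists \<Omega>" "s \<in> carrier G" "Bs \<in> lists nonempty_sets"
    and "J \<in> lists \<Omega>" "r \<in> carrier G" "Cs \<in> lists nonempty_sets"
    and "\<And>w. w \<in> lists \<Omega> \<Longrightarrow> N \<le> length w \<Longrightarrow> word_act (nf I s Bs) w = word_act (nf J r Cs) w"
  shows "nf I s Bs = nf J r Cs"
proof -
  have "I = J \<and> s = r \<and> Bs = Cs"
    using assms(3,6,7)
  proof (induction Bs arbitrary: Cs rule: rev_induct)
    case Nil
    show ?case
    proof (cases Cs rule: rev_cases)
      case Nil': Nil
      let ?w = "replicate N None"
      have "Some \<one> # ?w \<in> lists \<Omega>" by (auto simp: points_def)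
      from Nil(3)[OF this] show ?thesis
        using assms Nil' by (simp add: word_act_nf_Nil scale_def)
    next
      case (snoc Cs' C)
      then have "C \<subseteq> \<Omega>" using Nil by simp
      from nf_Nil_neq_snoc[OF assms(1,2) this Nil(3)[unfolded snoc]] show ?thesis by blast
    qed
  next
    case (snoc B Bs)
    show ?case
    proof (cases Cs rule: rev_cases)
      case Nil
      have "B \<subseteq> \<Omega>" using snoc.prems by simp
      from nf_Nil_neq_snoc[OF assms(4,5) this snoc.prems(3)[symmetric, unfolded Nil]]
      show ?thesis by blast
    next
      case Cs: (snoc Cs' C)
      have BC: "Bs \<in> lists nonempty_sets" "Cs' \<in> lists nonempty_sets"
        "B \<in> nonempty_sets" "C \<in> nonempty_sets"
        using snoc.prems Cs by auto
      have eq: "(if x \<in> B then word_act (nf I s Bs) w else None) =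
          (if x \<in> C then word_act (nf J r Cs') w else None)"
        if "x \<in> \<Omega>" "w \<in> lists \<Omega>" "N \<le> length w" for x w
        using snoc.prems(3)[of "x # w"] that BC Cs by (simp add: word_act_nf_snoc)
      obtain x where x: "x \<in> B" "x \<in> \<Omega>" using BC by auto
      \<comment> \<open>On a continuation where the remaining form is defined, membership of the
        first point in the last set is visible as definedness.\<close>
      obtain w where w: "w \<in> lists \<Omega>" "N \<le> length w" "word_act (nf I s Bs) w \<noteq> None"
        using nf_not_zero[OF assms(1,2) BC(1)] by blast
      obtain w' where w': "w' \<in> lists \<Omega>" "N \<le> length w'" "word_act (nf J r Cs') w' \<noteq> None"
        using nf_not_zero[OF assms(4,5) BC(2)] by blast
      have "x \<in> C" if "x \<in> B" for x
        using eq[OF _ w(1,2), of x] w(3) that BC by (auto split: if_splits)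
      moreover have "x \<in> B" if "x \<in> C" for x
        using eq[OF _ w'(1,2), of x] w'(3) that BC by (auto split: if_splits)
      ultimately have "B = C" by blast
      moreover have "I = J \<and> s = r \<and> Bs = Cs'"
      proof (rule snoc.IH[OF BC(1,2)])
        fix w assume "w \<in> lists \<Omega>" "N \<le> length w"
        from eq[OF x(2) this] x \<open>B = C\<close> show "word_act (nf I s Bs) w = word_act (nf J r Cs') w"
          by simp
      qed
      ultimately show ?thesis using Cs by simp
    qed
  qed
  then show ?thesis by simp
qed

end

section \<open>Computing modulo a congruence that contains the relations\<close>

text \<open>The congruence is a parameter because the calculations are used twice: for the generated
  congruence and for an arbitrary larger one.\<close>

locale letter_congruence = coded_letters +
  fixes \<sigma> :: "(nat list \<times> nat list) set"
  assumes congruence: "congruence_on F \<sigma>" and rels: "rels \<subseteq> \<sigma>"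
begin

abbreviation related (infix "\<approx>" 50) where "u \<approx> v \<equiv> (u, v) \<in> \<sigma>"

lemma equiv_rel: "equiv (lists A) \<sigma>"
  using congruence by (simp add: congruence_on_def)

lemma rel_carrier: "u \<approx> v \<Longrightarrow> u \<in> lists A" "u \<approx> v \<Longrightarrow> v \<in> lists A"
  using equiv_rel by (auto simp: equiv_def)

lemma rel_refl: "u \<in> lists A \<Longrightarrow> u \<approx> u"
  using equiv_rel by (auto simp: equiv_def refl_on_def)

lemma rel_sym: "u \<approx> v \<Longrightarrow> v \<approx> u"
  using equiv_rel by (auto simp: equiv_def dest: symD)

lemma rel_trans [trans]: "u \<approx> v \<Longrightarrow> v \<approx> w \<Longrightarrow> u \<approx> w"
  using equiv_rel unfolding equiv_def by (blast dest: transD)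

lemma rel_append: "u \<approx> u' \<Longrightarrow> v \<approx> v' \<Longrightarrow> u @ v \<approx> u' @ v'"
  using congruence_on_mult[OF monoid_F congruence] by simp

lemma rel_Cons: "a \<in> A \<Longrightarrow> u \<approx> v \<Longrightarrow> a # u \<approx> a # v"
  using rel_append[OF rel_refl[of "[a]"]] by simp

lemma rel_head: "[a, b] \<approx> v \<Longrightarrow> u \<in> lists A \<Longrightarrow> a # b # u \<approx> v @ u"
  using rel_append[OF _ rel_refl, of "[a, b]"] by simp

lemmas pop_push = subsetD[OF rels rels.pop_push]
  and scale_push = subsetD[OF rels rels.scale_push]
  and pop_scale = subsetD[OF rels rels.pop_scale]
  and scale_mult = subsetD[OF rels rels.scale_mult]
  and scale_one = subsetD[OF rels rels.scale_one]
  and zero_right = subsetD[OF rels rels.zero_right]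
  and zero_left = subsetD[OF rels rels.zero_left]

lemma zero_append: "u \<in> lists A \<Longrightarrow> zero @ u \<approx> zero"
proof (induction u)
  case Nil
  then show ?case by (simp add: rel_refl)
next
  case (Cons a u)
  then have "zero @ a # u \<approx> zero @ u"
    using rel_head[OF zero_left[of a], of u] by simp
  also have "zero @ u \<approx> zero" using Cons by simp
  finally show ?case .
qed

text \<open>Put one letter in front of a normal form. A push joins \<open>I\<close>; a scaling is
  absorbed by the first push or by the scaling letter; a pop cancels the first push or gives zero,
  and if there is no push it swallows the scaling letter and becomes a pop of a preimage.\<close>

lemma normal_form:
  assumes "u \<in> lists A"
  shows "u \<approx> zero \<or>
    (\<exists>I \<in> lists \<Omega>. \<exists>s \<in> carrier G. \<exists>Bs \<in> lists nonempty_sets. u \<approx> nf I s Bs)"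
  using assms
proof (induction u)
  case Nil
  have "[] \<approx> nf [] \<one> []" using rel_sym[OF scale_one] by (simp add: nf_def)
  then show ?case by (metis lists.Nil one_closed)
next
  case (Cons a u)
  have a: "a \<in> A" using Cons by simp
  consider "u \<approx> zero" | I s Bs where "I \<in> lists \<Omega>" "s \<in> carrier G" "Bs \<in> lists nonempty_sets"
    "u \<approx> nf I s Bs"
    using Cons by auto
  then show ?case
  proof cases
    case 1
    then show ?thesis using rel_trans[OF rel_Cons[OF a] zero_right[OF a]] by simp
  next
    case 2
    then have au: "a # u \<approx> a # nf I s Bs" using rel_Cons[OF a] by simp
    have tail: "map (\<lambda>B. p B) Bs \<in> lists A" using 2(3) by auto
    have I: "map (\<lambda>x. q x) I \<in> lists A" if "I \<in> lists \<Omega>" for I using that by auto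
    have nfA: "nf I s Bs \<in> lists A" if "I \<in> lists \<Omega>" for I
      using tail I[OF that] 2 by (simp add: nf_def)
    have found: ?thesis
      if "a # nf I s Bs \<approx> nf J r Cs" "J \<in> lists \<Omega>" "r \<in> carrier G" "Cs \<in> lists nonempty_sets"
      for J r Cs
      using rel_trans[OF au that(1)] that by blast
    have found0: ?thesis if "a # nf I s Bs \<approx> zero"
      using rel_trans[OF au that(1)] that by blast
    from a show ?thesis
    proof (cases rule: letters_cases)
      case (push x)
      have "a # nf I s Bs \<approx> nf (x # I) s Bs"
        using push 2 rel_refl[of "a # nf I s Bs"] nfA a by (simp add: nf_def)
      then show ?thesis using found 2 push by simp
    next
      case (pop B)
      show ?thesis
      proof (cases I)
        case Nil
        have *: "a # nf I s Bs \<approx> p (preim s B) # map (\<lambda>B. p B) Bs"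
          using rel_head[OF pop_scale[of B s] tail] pop 2 Nil by (simp add: nf_def)
        show ?thesis
        proof (cases "preim s B = {}")
          case True
          with * have "a # nf I s Bs \<approx> zero"
            using rel_trans zero_append[OF tail] by simp
          then show ?thesis by (rule found0)
        next
          case False
          \<comment> \<open>The pop has consumed the scaling letter, so \<open>t \<one>\<close> is
            inserted to restore the shape.\<close>
          have "p (preim s B) # map (\<lambda>B. p B) Bs \<approx> nf [] \<one> (preim s B # Bs)"
            using rel_append[OF rel_sym[OF scale_one] rel_refl[of "p (preim s B) # map (\<lambda>B. p B) Bs"]]
              tail by (simp add: nf_def)
          then show ?thesis
            using found[OF rel_trans[OF *]] False 2 by simp
        qed
      next
        case (Cons x J)
        have *: "a # nf I s Bs \<approx> (if x \<in> B then [] else zero) @ nf J s Bs"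
          using rel_head[OF pop_push[of B x] nfA[of J]] pop 2 Cons by (simp add: nf_def)
        show ?thesis
        proof (cases "x \<in> B")
          case True
          then show ?thesis using found[of J s Bs] * 2 Cons by simp
        next
          case False
          then show ?thesis using found0 rel_trans[OF * ] zero_append[OF nfA[of J]] 2 Cons by simp
        qed
      qed
    next
      case (scale r)
      show ?thesis
      proof (cases I)
        case Nil
        have "a # nf I s Bs \<approx> nf [] (r \<otimes> s) Bs"
          using rel_head[OF scale_mult[of r s] tail] scale 2 Nil by (simp add: nf_def)
        then show ?thesis using found 2 scale by simp
      next
        case (Cons x J)
        have "a # nf I s Bs \<approx> nf (scale r x # J) s Bs"
          using rel_head[OF scale_push[of r x] nfA[of J]] scale 2 Cons by (simp add: nf_def)
        then show ?thesis using found 2 scale Cons by simp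
      qed
    qed
  qed
qed

text \<open>The relations carry out the action: every letter of \<open>u\<close> meets a push that
  it can act on. The length bound ensures that the pushes do not run out, as no relation removes a
  lone pop of a nonempty set.\<close>

lemma append_push:
  assumes "u \<in> lists A" "w \<in> lists \<Omega>" "length u \<le> length w"
  shows "u @ map (\<lambda>x. q x) w \<approx>
    (case word_act u w of None \<Rightarrow> zero | Some w' \<Rightarrow> map (\<lambda>x. q x) w')"
  using assms(1,3)
proof (induction u)
  case Nil
  have "map (\<lambda>x. q x) w \<in> lists A" using assms by auto
  then show ?case by (simp add: rel_refl)
next
  case (Cons a u)
  have a: "a \<in> A" using Cons by simp
  have IH: "(a # u) @ map (\<lambda>x. q x) w \<approx>
    a # (case word_act u w of None \<Rightarrow> zero | Some w' \<Rightarrow> map (\<lambda>x. q x) w')"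
    using Cons rel_Cons by simp
  show ?case
  proof (cases "word_act u w")
    case None
    then show ?thesis using rel_trans[OF IH] zero_right[OF a] by simp
  next
    case (Some w')
    have "length w \<le> length w' + length u"
      using length_word_act[OF _ assms(2) Some] Cons by simp
    then obtain x v where w': "w' = x # v"
      using Cons.prems by (cases w') auto
    have "u \<in> lists A" using Cons by simp
    from word_act_closed[OF this assms(2) Some] have mem: "x \<in> \<Omega>" "v \<in> lists \<Omega>"
      using w' by simp_all
    have vA: "map (\<lambda>x. q x) v \<in> lists A" using mem by auto
    have IH': "(a # u) @ map (\<lambda>x. q x) w \<approx> a # q x # map (\<lambda>x. q x) v"
      using IH Some w' by simp
    from a show ?thesis
    proof (cases rule: letters_cases)
      case (push y)
      then show ?thesis using IH' Some w' by simp
    next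
      case (pop B)
      note * = rel_trans[OF IH' rel_head[OF pop_push[of B x, folded pop(2)] vA]]
      show ?thesis
      proof (cases "x \<in> B")
        case True
        with * pop mem Some w' show ?thesis by simp
      next
        case False
        with rel_trans[OF *] zero_append[OF vA] pop mem Some w' show ?thesis by simp
      qed
    next
      case (scale r)
      show ?thesis
        using rel_trans[OF IH' rel_head[OF scale_push[of r x, folded scale(2)] vA]] scale mem Some w'
        by simp
    qed
  qed
qed

section \<open>Identifications that collapse the monoid\<close>

lemma universal_if_one_zero:
  assumes "[] \<approx> zero"
  shows "\<sigma> = lists A \<times> lists A"
proof -
  have zero: "u \<approx> zero" if "u \<in> lists A" for u
  proof -
    have "[] @ u \<approx> zero @ u" using rel_append[OF assms rel_refl[OF that]] .
    also note zero_append[OF that]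
    finally show ?thesis by simp
  qed
  show ?thesis
  proof (intro equalityI subrelI)
    fix u v assume "u \<approx> v"
    from rel_carrier[OF this] show "(u, v) \<in> lists A \<times> lists A" by (rule SigmaI)
  next
    fix u v assume "(u, v) \<in> lists A \<times> lists A"
    then show "u \<approx> v" using zero rel_trans[OF _ rel_sym] by blast
  qed
qed

lemma pop_push_list:
  assumes "B \<subseteq> \<Omega>" "x \<in> \<Omega>" "w \<in> lists \<Omega>"
  shows "p B # map (\<lambda>x. q x) (x # w) \<approx> (if x \<in> B then map (\<lambda>x. q x) w else zero)"
proof -
  have w: "map (\<lambda>x. q x) w \<in> lists A" using assms by auto
  note * = rel_head[OF pop_push[OF assms(1,2)] w]
  show ?thesis
  proof (cases "x \<in> B")
    case True
    with * show ?thesis by simp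
  next
    case False
    with rel_trans[OF *] zero_append[OF w] show ?thesis by simp
  qed
qed

text \<open>Since \<open>p {x}\<close> is a left inverse of \<open>q x\<close>, pushes can be
  stripped from the left while zero stays zero.\<close>

lemma one_zero_if_push_zero:
  "w \<in> lists \<Omega> \<Longrightarrow> map (\<lambda>x. q x) w \<approx> zero \<Longrightarrow> [] \<approx> zero"
proof (induction w)
  case (Cons x w)
  then have x: "{x} \<subseteq> \<Omega>" and w: "w \<in> lists \<Omega>" by auto
  have "map (\<lambda>x. q x) w \<approx> p {x} # map (\<lambda>x. q x) (x # w)"
    using rel_sym[OF pop_push_list[OF x _ w, of x]] x by simp
  also have "p {x} # map (\<lambda>x. q x) (x # w) \<approx> [p {x}, p {}]" using rel_Cons Cons.prems x by simp
  also have "[p {x}, p {}] \<approx> zero" using zero_right x by simp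
  finally show ?case using Cons.IH w by simp
qed simp

lemma one_zero_if_one_push:
  assumes "x \<in> \<Omega>" "w \<in> lists \<Omega>" "[] \<approx> map (\<lambda>x. q x) (x # w)"
  shows "[] \<approx> zero"
proof -
  \<comment> \<open>A point other than \<open>x\<close>: then \<open>p {y}\<close> kills
    \<open>q x\<close>, so the hypothesis makes \<open>p {y}\<close> zero, while
    \<open>p {y}\<close> times \<open>q y\<close> is the identity.\<close>
  define y where "y = (if x = None then Some \<one> else None)"
  have y: "{y} \<subseteq> \<Omega>" "x \<notin> {y}" by (auto simp: y_def points_def)
  then have "[p {y}] \<approx> zero"
    using rel_trans[OF rel_Cons[OF _ assms(3)] pop_push_list[OF y(1) assms(1,2)]] by simp
  then have "[p {y}, q y] \<approx> [p {}, q y]"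
    using rel_append[OF _ rel_refl[of "[q y]"]] y by fastforce
  also have "[p {}, q y] \<approx> zero" using zero_left y by simp
  finally have "[p {y}, q y] \<approx> zero" .
  moreover have "[p {y}, q y] \<approx> []" using pop_push[OF y(1), of y] y by simp
  ultimately show ?thesis by (blast intro: rel_trans rel_sym)
qed

text \<open>Strip equal first letters with \<open>p {x}\<close>. At the first difference, either one
  side becomes zero or one word is already exhausted, and the two preceding lemmas apply.\<close>

lemma one_zero_if_push_push:
  "w \<in> lists \<Omega> \<Longrightarrow> v \<in> lists \<Omega> \<Longrightarrow> w \<noteq> v \<Longrightarrow>
    map (\<lambda>x. q x) w \<approx> map (\<lambda>x. q x) v \<Longrightarrow> [] \<approx> zero"
proof (induction w arbitrary: v)
  case Nil
  then obtain x v' where "v = x # v'" by (cases v) auto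
  then show ?case using one_zero_if_one_push[of x v'] Nil by simp
next
  case (Cons x w)
  show ?case
  proof (cases v)
    case Nil
    then show ?thesis using one_zero_if_one_push[of x w] Cons.prems rel_sym by simp
  next
    case v: (Cons y v')
    have x: "{x} \<subseteq> \<Omega>" and w: "w \<in> lists \<Omega>" and y: "y \<in> \<Omega>" and v': "v' \<in> lists \<Omega>"
      using Cons.prems v by auto
    have "map (\<lambda>x. q x) w \<approx> p {x} # map (\<lambda>x. q x) (x # w)"
      using rel_sym[OF pop_push_list[OF x _ w, of x]] x by simp
    also have "p {x} # map (\<lambda>x. q x) (x # w) \<approx> p {x} # map (\<lambda>x. q x) (y # v')"
      using rel_Cons[OF _ Cons.prems(4)] x v by simp
    also have "p {x} # map (\<lambda>x. q x) (y # v') \<approx> (if y \<in> {x} then map (\<lambda>x. q x) v' else zero)"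
      by (rule pop_push_list[OF x y v'])
    finally have *: "map (\<lambda>x. q x) w \<approx> (if y \<in> {x} then map (\<lambda>x. q x) v' else zero)" .
    show ?thesis
    proof (cases "y = x")
      case True
      then show ?thesis using Cons.IH[OF w v'] Cons.prems v * by simp
    next
      case False
      then show ?thesis using one_zero_if_push_zero[OF w] * by simp
    qed
  qed
qed

text \<open>Multiplying both sides on the right by the pushes of \<open>w\<close> turns them into
  zero or the pushes of the image of \<open>w\<close>. Different images would force the identity to
  equal zero. The bound is large enough to use \<open>append_push\<close> for both words.\<close>

lemma word_act_eq:
  assumes "u \<approx> v" "\<not> [] \<approx> zero" "w \<in> lists \<Omega>" "length u + length v \<le> length w"
  shows "word_act u w = word_act v w"
proof (rule ccontr)
  assume neq: "word_act u w \<noteq> word_act v w"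
  let ?push = "\<lambda>r. case r of None \<Rightarrow> zero | Some w' \<Rightarrow> map (\<lambda>x. q x) w'"
  have mem: "u \<in> lists A" "v \<in> lists A" using rel_carrier assms(1) by auto
  have "map (\<lambda>x. q x) w \<in> lists A" using assms(3) by auto
  then have uv: "u @ map (\<lambda>x. q x) w \<approx> v @ map (\<lambda>x. q x) w"
    using rel_append[OF assms(1) rel_refl] by simp
  have "?push (word_act u w) \<approx> u @ map (\<lambda>x. q x) w"
    using rel_sym append_push[OF mem(1) assms(3)] assms(4) by simp
  also note uv
  also have "v @ map (\<lambda>x. q x) w \<approx> ?push (word_act v w)"
    using append_push[OF mem(2) assms(3)] assms(4) by simp
  finally have *: "?push (word_act u w) \<approx> ?push (word_act v w)" .
  note closed = word_act_closed[OF mem(1) assms(3)] word_act_closed[OF mem(2) assms(3)]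
  show False
    using * neq closed assms(2) one_zero_if_push_zero one_zero_if_push_push rel_sym
    by (cases "word_act u w"; cases "word_act v w") auto
qed

end

section \<open>The presented monoid is congruence-free and contains \<open>G\<close>\<close>

context coded_letters
begin

abbreviation "\<gamma> \<equiv> congruence_generated F rels"

sublocale gen: letter_congruence G code \<gamma>
proof unfold_locales
  show "congruence_on F \<gamma>"
    using congruence_on_generated[OF monoid_F] rels_subset by simp
  show "rels \<subseteq> \<gamma>"
    by (rule subset_congruence_generated)
qed

lemma word_act_gen: "(u, v) \<in> \<gamma> \<Longrightarrow> w \<in> lists \<Omega> \<Longrightarrow> word_act u w = word_act v w"
  using congruence_generated_least[OF congruence_same_action rels_same_action]
  by (auto simp: same_action_def)

text \<open>Completeness of the relations: reduce both words to zero or a normal form; the action on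
  long words distinguishes normal forms from zero and from each other.\<close>

lemma gen_if_word_act_eq:
  assumes "u \<in> lists A" "v \<in> lists A"
    and eq: "\<And>w. w \<in> lists \<Omega> \<Longrightarrow> N \<le> length w \<Longrightarrow> word_act u w = word_act v w"
  shows "(u, v) \<in> \<gamma>"
proof -
  have zero: "(v, zero) \<in> \<gamma>"
    if "(u, zero) \<in> \<gamma>" "v \<in> lists A"
      and "\<And>w. w \<in> lists \<Omega> \<Longrightarrow> N \<le> length w \<Longrightarrow> word_act u w = word_act v w" for u v
    using gen.normal_form[OF that(2)]
  proof (elim disjE bexE)
    fix I s Bs assume *: "I \<in> lists \<Omega>" "s \<in> carrier G" "Bs \<in> lists nonempty_sets"
      and v: "(v, nf I s Bs) \<in> \<gamma>"
    from nf_not_zero[OF *, of N] obtain w where w: "w \<in> lists \<Omega>" "N \<le> length w"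
      "word_act (nf I s Bs) w \<noteq> None" by auto
    then have False
      using that(3)[OF w(1,2)] word_act_gen[OF that(1) w(1)] word_act_gen[OF v w(1)]
      by (simp del: word_act.simps)
    then show ?thesis ..
  qed
  consider "(u, zero) \<in> \<gamma>" | "(v, zero) \<in> \<gamma>" | I s Bs J r Cs where
    "I \<in> lists \<Omega>" "s \<in> carrier G" "Bs \<in> lists nonempty_sets" "(u, nf I s Bs) \<in> \<gamma>"
    "J \<in> lists \<Omega>" "r \<in> carrier G" "Cs \<in> lists nonempty_sets" "(v, nf J r Cs) \<in> \<gamma>"
    using gen.normal_form[OF assms(1)] gen.normal_form[OF assms(2)] by metis
  then show ?thesis
  proof cases
    case 1
    with zero[OF 1 assms(2) eq] show ?thesis by (blast intro: gen.rel_trans gen.rel_sym)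
  next
    case 2
    with zero[OF 2 assms(1) eq[symmetric]] show ?thesis
      by (blast intro: gen.rel_trans gen.rel_sym)
  next
    case 3
    have "nf I s Bs = nf J r Cs"
      using nf_faithful[OF 3(1-3,5-7), of N] eq word_act_gen[OF 3(4)] word_act_gen[OF 3(8)] by simp
    with 3(4,8) show ?thesis by (metis gen.rel_trans gen.rel_sym)
  qed
qed

text \<open>A congruence above \<open>\<gamma>\<close> that separates the identity from zero relates
  only words with equal action on long inputs, and these are already related by
  \<open>\<gamma>\<close>.\<close>

lemma congruence_free_presented: "congruence_free (presented_monoid A rels)"
  unfolding presented_monoid_def
proof (rule congruence_free_quotient_monoid[OF monoid_F gen.congruence])
  fix \<sigma> assume \<sigma>: "congruence_on F \<sigma>" "\<gamma> \<subseteq> \<sigma>"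
  interpret \<sigma>: letter_congruence G code \<sigma>
    using \<sigma> gen.rels by unfold_locales auto
  show "\<sigma> = \<gamma> \<or> \<sigma> = carrier F \<times> carrier F"
  proof (cases "([], zero) \<in> \<sigma>")
    case True
    then show ?thesis using \<sigma>.universal_if_one_zero by simp
  next
    case False
    have "(u, v) \<in> \<gamma>" if "(u, v) \<in> \<sigma>" for u v
      \<comment> \<open>The threshold for long inputs is \<open>length u + length v\<close>; it may
        depend on the pair.\<close>
      using gen_if_word_act_eq[OF \<sigma>.rel_carrier[OF that]] \<sigma>.word_act_eq[OF that False] by blast
    then show ?thesis using \<sigma> by auto
  qed
qed

lemma finitely_presented_presented: "finitely_presented (presented_monoid A rels)"
  unfolding finitely_presented_def
  by (rule exI[of _ A], rule exI[of _ rels])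
    (simp add: finite_letters finite_rels rels_subset iso_refl)

text \<open>Multiplicativity is a defining relation. Injectivity is read off from the action on the
  one-letter word \<open>[Some \<one>]\<close>, which returns the scalar.\<close>

lemma scale_in_mon: "(\<lambda>s. \<gamma> `` {[t s]}) \<in> mon G (presented_monoid A rels)"
  unfolding mon_def presented_monoid_def
proof (intro CollectI conjI)
  show "(\<lambda>s. \<gamma> `` {[t s]}) \<in> hom G (quotient_monoid F \<gamma>)"
  proof (rule homI)
    fix s r assume sr: "s \<in> carrier G" "r \<in> carrier G"
    show "\<gamma> `` {[t s]} \<in> carrier (quotient_monoid F \<gamma>)"
      using sr by (auto simp: quotient_monoid_def intro!: quotientI)
    have "\<gamma> `` {[t s]} \<otimes>\<^bsub>quotient_monoid F \<gamma>\<^esub> \<gamma> `` {[t r]} = \<gamma> `` {[t s, t r]}"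
      using quotient_monoid_mult[OF monoid_F gen.congruence, of "[t s]" "[t r]"] sr by simp
    also have "\<dots> = \<gamma> `` {[t (s \<otimes> r)]}"
      by (rule equiv_class_eq[OF gen.equiv_rel gen.scale_mult[OF sr]])
    finally show "\<gamma> `` {[t (s \<otimes> r)]} =
      \<gamma> `` {[t s]} \<otimes>\<^bsub>quotient_monoid F \<gamma>\<^esub> \<gamma> `` {[t r]}" ..
  qed
  show "inj_on (\<lambda>s. \<gamma> `` {[t s]}) (carrier G)"
  proof (rule inj_onI)
    fix s r assume sr: "s \<in> carrier G" "r \<in> carrier G" and "\<gamma> `` {[t s]} = \<gamma> `` {[t r]}"
    then have "([t s], [t r]) \<in> \<gamma>"
      using eq_equiv_class[OF _ gen.equiv_rel, of "[t s]" "[t r]"] by simp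
    then have "word_act [t s] [Some \<one>] = word_act [t r] [Some \<one>]"
      by (rule word_act_gen) (simp add: points_def)
    then show "s = r" using sr by (simp add: scale_def)
  qed
qed

end

theorem theorem2p1:
  fixes S :: "('a, 'b) monoid_scheme"
  assumes "semigroup_carrier S" and "finite (carrier S)"
  shows "\<exists>(M :: nat list set monoid) h.
    monoid M \<and> finitely_presented M \<and> congruence_free M \<and> h \<in> mon S M"
proof -
  let ?G = "adjoin_one S"
  interpret monoid ?G by (rule monoid_adjoin_one[OF assms(1)])
  have fin: "finite (carrier ?G)"
    using assms(2) by (simp add: adjoin_one_def)
  then have "finite (letters ?G)"
    by (simp add: letters_def points_def)
  then obtain code :: "'a option letter \<Rightarrow> nat" where "inj_on code (letters ?G)"
    using finite_imp_inj_to_nat_seg by blast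
  then interpret coded_letters ?G code
    using fin by unfold_locales
  let ?M = "presented_monoid A rels"
  have "(\<lambda>s. \<gamma> `` {[t s]}) \<circ> Some \<in> mon S ?M"
    by (rule mon_compose[OF Some_in_mon_adjoin_one scale_in_mon])
  then show ?thesis
    using monoid_presented_monoid[OF rels_subset] finitely_presented_presented
      congruence_free_presented by blast
qed

end
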